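(* Let $E$ be a nonzero real Banach space and $S\colon E\rightrightarrows E^*$ be maximally monotone. Then the following are equivalent: (a) $S$ is quasidense; (b) $S$ is of type (FP); (c) for all $(w^*,w^{**})\in E^*\times E^{**}$, $\inf_{(s,s^* )\in G(S)}\langle s^*-w^*,\widehat s-w^{**}\rangle\le0$.
   Context: $\widehat s\in E^{**}$ is the canonical image of $s\in E$. $S$ (with nonempty graph $G(S)$ and range $R(S)$) is monotone if $\langle s-t,s^*-t^*\rangle\ge0$ on $G(S)$, maximally monotone if no monotone multifunction has a strictly larger graph; quasidense if for every $(x,x^* )\in E\times E^*$, $\inf_{(s,s^* )\in G(S)}[\tfrac12\|s-x\|^2+\tfrac12\|s^*-x^*\|^2+\langle s-x,s^*-x^*\rangle]\le0$. A monotone $S$ is of type (FP) if whenever $\widetilde U$ is an open convex subset of $E^*$ with $\widetilde U\cap R(S)\ne\emptyset$, $(w,w^* )\in E\times\widetilde U$, and $\langle s-w,s^*-w^*\rangle\ge0$ for all $(s,s^* )\in G(S)$ with $s^*\in\widetilde U$, then $(w,w^* )\in G(S)$. *)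

theory Defs
  imports "HOL-Analysis.Analysis"
begin

(* E is a real Banach space ('a::banach); E* is 'a \<Rightarrow>\<^sub>L real (norm = operator norm),
  E** is ('a \<Rightarrow>\<^sub>L real) \<Rightarrow>\<^sub>L real. A multifunction S : E \<rightrightarrows> E* is represented by its graph. *)

definition canon :: "'a::real_normed_vector \<Rightarrow> (('a \<Rightarrow>\<^sub>L real) \<Rightarrow>\<^sub>L real)" where
  "canon s = Blinfun (\<lambda>x'. blinfun_apply x' s)"

definition range_mf :: "('a \<times> 'b) set \<Rightarrow> 'b set" where
  "range_mf G = snd ` G"

definition monotone_mf :: "('a::real_normed_vector \<times> ('a \<Rightarrow>\<^sub>L real)) set \<Rightarrow> bool" where
  "monotone_mf G \<longleftrightarrow> (\<forall>(s, s')\<in>G. \<forall>(t, t')\<in>G. blinfun_apply (s' - t') (s - t) \<ge> 0)"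

definition maximally_monotone :: "('a::real_normed_vector \<times> ('a \<Rightarrow>\<^sub>L real)) set \<Rightarrow> bool" where
  "maximally_monotone G \<longleftrightarrow> monotone_mf G \<and>
     (\<forall>H. monotone_mf H \<and> G \<subseteq> H \<longrightarrow> H = G)"

definition quasidense :: "('a::real_normed_vector \<times> ('a \<Rightarrow>\<^sub>L real)) set \<Rightarrow> bool" where
  "quasidense G \<longleftrightarrow> (\<forall>x x'.
     (INF p\<in>G. ereal ((norm (fst p - x))\<^sup>2 / 2 + (norm (snd p - x'))\<^sup>2 / 2
                       + blinfun_apply (snd p - x') (fst p - x))) \<le> 0)"

definition type_FP :: "('a::real_normed_vector \<times> ('a \<Rightarrow>\<^sub>L real)) set \<Rightarrow> bool" where
  "type_FP G \<longleftrightarrow> monotone_mf G \<and> (\<forall>U w w'.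
     open U \<and> convex U \<and> U \<inter> range_mf G \<noteq> {} \<and> w' \<in> U \<and>
     (\<forall>(s, s')\<in>G. s' \<in> U \<longrightarrow> blinfun_apply (s' - w') (s - w) \<ge> 0)
     \<longrightarrow> (w, w') \<in> G)"

end

theory Submission
  imports Defs
begin

text \<open>
  Write q(x, x') = x'(x) and let (c) be the negative infimum condition NI.

  Quasidensity implies NI: given (w', w''), apply quasidensity at (0, w' - y') where y' nearly
  minimizes norm(y')^2/2 + w''(y').  FP implies NI: if NI fails at (w', w'') by a margin, some w
  agreeing with w'' on one functional s0' - w' with s0' in the range is monotonically related to the
  part of the graph over a thin tube around the segment from w' to s0', so (w, w') lies in the
  graph, which is absurd.

  For the converses, NI says that the conjugate of the Fitzpatrick function dominates the pairing of
  the dual and the bidual.  By Fenchel duality with norm^2/2, near every c there are points b of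
  small enlargements of the graph with q(b - c) + norm(b - c)^2/2 small.  Iterating this at the
  points found gives a Cauchy sequence, so such b are close to the graph, which is quasidensity.
  The domination survives inf-convolving the Fitzpatrick function with the support function of a
  neighbourhood K of the segment from w' to s0' and restricting it to K; the graph points obtained
  by the same argument lie over the given open set and converge to (w, w').
\<close>

section \<open>Hahn-Banach and the sandwich theorem\<close>

definition minorized_cone :: "('a::real_vector \<times> real) set \<Rightarrow> bool" where
  "minorized_cone C \<longleftrightarrow> convex_cone C \<and> (\<forall>v. (0, v) \<in> C \<longrightarrow> 0 \<le> v)"

definition maximal_minorized_cone :: "('a::real_vector \<times> real) set \<Rightarrow> bool" where
  "maximal_minorized_cone M \<longleftrightarrow>
     minorized_cone M \<and> (\<forall>N. minorized_cone N \<and> M \<subseteq> N \<longrightarrow> N = M)"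

lemma convex_cone_Union_chain:
  assumes nonempty: "\<C> \<noteq> {}"
    and chain: "\<And>C D. C \<in> \<C> \<Longrightarrow> D \<in> \<C> \<Longrightarrow> C \<subseteq> D \<or> D \<subseteq> C"
    and cone: "\<And>C. C \<in> \<C> \<Longrightarrow> convex_cone C"
  shows "convex_cone (\<Union>\<C>)"
  unfolding convex_cone_iff
proof (intro conjI ballI allI impI)
  show "0 \<in> \<Union>\<C>" using nonempty cone convex_cone_contains_0 by blast
  show "x + y \<in> \<Union>\<C>" if xy: "x \<in> \<Union>\<C>" "y \<in> \<Union>\<C>" for x y
  proof -
    obtain C where "C \<in> \<C>" "x \<in> C" "y \<in> C" using xy chain by (meson UnionE subsetD)
    then show ?thesis using convex_cone_add[OF cone] by blast
  qed
  show "c *\<^sub>R x \<in> \<Union>\<C>" if "x \<in> \<Union>\<C>" "0 \<le> c" for x c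
    using that cone convex_cone_scaleR by blast
qed

lemma maximal_minorized_cone_exists:
  assumes "minorized_cone C"
  obtains M where "C \<subseteq> M" "maximal_minorized_cone M"
proof -
  define \<A> where "\<A> = {D. minorized_cone D \<and> C \<subseteq> D}"
  have "\<exists>M\<in>\<A>. \<forall>X\<in>\<A>. M \<subseteq> X \<longrightarrow> X = M"
  proof (rule subset_Zorn_nonempty)
    show "\<A> \<noteq> {}" using assms by (auto simp: \<A>_def)
  next
    fix \<C> assume \<C>: "\<C> \<noteq> {}" "subset.chain \<A> \<C>"
    then have members: "minorized_cone D" "C \<subseteq> D" if "D \<in> \<C>" for D
      using that by (auto simp: subset_chain_def \<A>_def)
    have "convex_cone (\<Union>\<C>)"
      using \<C> members
      by (intro convex_cone_Union_chain) (auto simp: subset_chain_def minorized_cone_def)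
    then show "\<Union>\<C> \<in> \<A>"
      using \<C>(1) members by (fastforce simp: \<A>_def minorized_cone_def)
  qed
  then show thesis using that by (auto simp: \<A>_def maximal_minorized_cone_def dest: order_trans)
qed

lemma maximal_minorized_cone_mem_or_opposite:
  assumes "maximal_minorized_cone M"
  shows "(y, t) \<in> M \<or> (\<exists>r < - t. (- y, r) \<in> M)"
proof -
  have cone: "convex_cone M" and zero: "\<And>v. (0, v) \<in> M \<Longrightarrow> 0 \<le> v"
    and maximal: "\<And>N. minorized_cone N \<Longrightarrow> M \<subseteq> N \<Longrightarrow> N = M"
    using assms by (auto simp: maximal_minorized_cone_def minorized_cone_def)
  define N where "N = (\<Union>p\<in>M. \<Union>q\<in>convex_cone hull {(y, t)}. {p + q})"
  have "convex_cone N"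
    unfolding N_def by (intro convex_cone_sums cone convex_cone_convex_cone_hull)
  have "M \<subseteq> N" unfolding N_def using convex_cone_hull_contains_0[of "{(y, t)}"] by force
  have "(y, t) \<in> N"
    unfolding N_def
    using convex_cone_contains_0[OF cone] hull_inc[of "(y, t)" "{(y, t)}" convex_cone] by force
  show ?thesis
  proof (cases "minorized_cone N")
    case True
    then show ?thesis using maximal \<open>M \<subseteq> N\<close> \<open>(y, t) \<in> N\<close> by blast
  next
    case False
    then obtain v where "(0, v) \<in> N" "v < 0"
      using \<open>convex_cone N\<close> by (auto simp: minorized_cone_def not_le)
    then obtain z w s where zw: "(z, w) \<in> M" and "0 \<le> s" "z + s *\<^sub>R y = 0" "w + s * t < 0"
      by (auto simp: N_def convex_cone_hull_convex_hull_nonempty zero_prod_def)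
    moreover have "s \<noteq> 0" using calculation zero by force
    ultimately have "s > 0" "z = - (s *\<^sub>R y)" by (simp_all add: eq_neg_iff_add_eq_0)
    then have "(- y, w / s) \<in> M"
      using convex_cone_scaleR[OF cone _ zw, of "1 / s"] by simp
    moreover have "w / s < - t" using \<open>s > 0\<close> \<open>w + s * t < 0\<close> by (simp add: field_simps)
    ultimately show ?thesis by blast
  qed
qed

lemma maximal_minorized_cone_lineality:
  assumes M: "maximal_minorized_cone M" and domain: "\<And>x. \<exists>v. (x, v) \<in> M"
  obtains v where "(y, v) \<in> M" "(- y, - v) \<in> M"
proof -
  have cone: "convex_cone M" and zero: "\<And>v. (0, v) \<in> M \<Longrightarrow> 0 \<le> v"
    using M by (auto simp: maximal_minorized_cone_def minorized_cone_def)
  define V where "V = {v. (y, v) \<in> M}"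
  have "V \<noteq> {}" using domain by (auto simp: V_def)
  have lower: "- r \<le> v" if "(- y, r) \<in> M" "v \<in> V" for r v
    using zero[of "r + v"] convex_cone_add[OF cone, of "(- y, r)" "(y, v)"] that
    by (auto simp: V_def)
  obtain r0 where "(- y, r0) \<in> M" using domain by blast
  then have "bdd_below V" using lower by (auto simp: bdd_below_def)
  have "(y, Inf V) \<in> M"
    using maximal_minorized_cone_mem_or_opposite[OF M, of y "Inf V"]
      cInf_greatest[OF \<open>V \<noteq> {}\<close> lower] by force
  moreover have "(- y, - Inf V) \<in> M"
    using maximal_minorized_cone_mem_or_opposite[OF M, of "- y" "- Inf V"]
      cInf_lower[OF _ \<open>bdd_below V\<close>] by (force simp: V_def)
  ultimately show thesis by (rule that)
qed

lemma minorized_cone_hull: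
  assumes "convex D" "D \<noteq> {}" and zero: "\<And>v. (0, v) \<in> D \<Longrightarrow> 0 \<le> v"
  shows "minorized_cone (convex_cone hull D)"
  unfolding minorized_cone_def
proof (intro conjI allI impI)
  fix v assume "(0, v) \<in> convex_cone hull D"
  then obtain s p where "0 \<le> s" "p \<in> D" "(0, v) = s *\<^sub>R p"
    using assms(1,2)
    by (auto simp: convex_cone_hull_convex_hull_nonempty hull_same simp del: scaleR_Pair)
  moreover obtain x w where "p = (x, w)" by (cases p)
  ultimately have "0 \<le> s" "(x, w) \<in> D" "s = 0 \<or> x = 0" "v = s * w" by auto
  then show "0 \<le> v" using zero by (cases "s = 0") auto
qed (rule convex_cone_convex_cone_hull)

text \<open>The functional is read off a maximal cone, whose lineality space is its graph.\<close>
theorem minorized_cone_linear_minorant: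
  assumes C: "minorized_cone C" and domain: "\<And>x. \<exists>v. (x, v) \<in> C"
  obtains f where "linear f" "\<And>x v. (x, v) \<in> C \<Longrightarrow> f x \<le> v"
proof -
  obtain M where "C \<subseteq> M" and M: "maximal_minorized_cone M"
    using maximal_minorized_cone_exists[OF C] .
  have cone: "convex_cone M" and zero: "\<And>v. (0, v) \<in> M \<Longrightarrow> 0 \<le> v"
    using M by (auto simp: maximal_minorized_cone_def minorized_cone_def)
  have "\<exists>v. (x, v) \<in> M" for x using domain \<open>C \<subseteq> M\<close> by blast
  then have "\<exists>v. (x, v) \<in> M \<and> (- x, - v) \<in> M" for x
    using maximal_minorized_cone_lineality[OF M] by metis
  then obtain f where f: "\<And>x. (x, f x) \<in> M" "\<And>x. (- x, - f x) \<in> M" by metis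
  have minorant: "f x \<le> v" if "(x, v) \<in> M" for x v
    using zero[of "v - f x"] convex_cone_add[OF cone that f(2)[of x]] by simp
  have unique: "f x = v" if "(x, v) \<in> M" "(- x, - v) \<in> M" for x v
    using minorant[OF that(1)] zero[of "f x - v"] convex_cone_add[OF cone f(1)[of x] that(2)]
    by simp
  have "linear f"
  proof (rule linearI)
    show "f (x + y) = f x + f y" for x y
      using convex_cone_add[OF cone f(1)[of x] f(1)[of y]]
        convex_cone_add[OF cone f(2)[of x] f(2)[of y]]
      by (intro unique) (simp_all add: add.commute)
    show "f (t *\<^sub>R x) = t *\<^sub>R f x" for t x
      using convex_cone_scaleR[OF cone _ f(1)[of x], of "\<bar>t\<bar>"]
        convex_cone_scaleR[OF cone _ f(2)[of x], of "\<bar>t\<bar>"]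
      by (cases "0 \<le> t"; intro unique) simp_all
  qed
  then show thesis using that minorant \<open>C \<subseteq> M\<close> by blast
qed

lemma linear_bounded_above_imp_bounded_linear:
  fixes f :: "'a::real_normed_vector \<Rightarrow> real"
  assumes "linear f" "\<And>x. f x \<le> norm x * B"
  shows "bounded_linear f"
proof (rule bounded_linear_intro)
  show "norm (f x) \<le> norm x * B" for x
    using assms(2)[of x] assms(2)[of "- x"] linear_neg[OF assms(1), of x] by simp
qed (simp_all add: assms(1) linear_add linear_scale)

lemma real_valued_separation:
  fixes f :: "'a \<Rightarrow> real" and g :: "'b \<Rightarrow> real"
  assumes "S \<noteq> {}" "T \<noteq> {}" and le: "\<And>x y. x \<in> S \<Longrightarrow> y \<in> T \<Longrightarrow> f x \<le> g y"
  obtains k where "\<And>x. x \<in> S \<Longrightarrow> f x \<le> k" "\<And>y. y \<in> T \<Longrightarrow> k \<le> g y"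
proof (rule that[of "SUP x\<in>S. f x"])
  obtain y where "y \<in> T" using \<open>T \<noteq> {}\<close> by blast
  then have "bdd_above (f ` S)" using le by (intro bdd_aboveI2[of S f "g y"]) auto
  then show "f x \<le> (SUP x\<in>S. f x)" if "x \<in> S" for x using that by (rule cSUP_upper2) simp
  show "(SUP x\<in>S. f x) \<le> g y" if "y \<in> T" for y
    using \<open>S \<noteq> {}\<close> le that by (intro cSUP_least)
qed

lemma convex_set_continuous_linear_minorant:
  fixes D :: "('a::real_normed_vector \<times> real) set"
  assumes D: "convex D" "\<And>v. (0, v) \<in> D \<Longrightarrow> 0 \<le> v"
    and r: "r > 0" "\<And>x. norm x \<le> r \<Longrightarrow> (x, B) \<in> D"
  obtains l :: "'a \<Rightarrow>\<^sub>L real" where "\<And>x v. (x, v) \<in> D \<Longrightarrow> l x \<le> v"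
proof -
  define C where "C = convex_cone hull D"
  have "D \<noteq> {}" using r(2)[of 0] r(1) by auto
  then have "minorized_cone C" unfolding C_def by (intro minorized_cone_hull D)
  moreover have growth: "(x, norm x * (B / r)) \<in> C" for x
  proof (cases "x = 0")
    case True
    then show ?thesis by (simp add: C_def convex_cone_hull_contains_0 flip: zero_prod_def)
  next
    case False
    then have "((r / norm x) *\<^sub>R x, B) \<in> C"
      unfolding C_def using r by (intro hull_inc r(2)) simp
    then show ?thesis
      using convex_cone_hull_mul[of "((r / norm x) *\<^sub>R x, B)" D "norm x / r"] False r(1)
      by (simp add: C_def)
  qed
  ultimately obtain f where "linear f" and minorant: "\<And>x v. (x, v) \<in> C \<Longrightarrow> f x \<le> v"
    using minorized_cone_linear_minorant[of C] by blast
  have "bounded_linear f"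
    using linear_bounded_above_imp_bounded_linear[OF \<open>linear f\<close> minorant[OF growth]] .
  then obtain l where "f = blinfun_apply l" by (metis bounded_linear_Blinfun_apply)
  then show thesis using minorant hull_inc[of _ D] by (intro that[of l]) (simp add: C_def)
qed

theorem convex_sandwich:
  fixes A :: "('a::real_normed_vector \<times> real) set"
  assumes A: "convex A" and g: "concave_on K g"
    and below: "\<And>x a. (x, a) \<in> A \<Longrightarrow> x \<in> K \<Longrightarrow> g x \<le> a"
    and x0: "(x0, a0) \<in> A" and r: "r > 0" "cball x0 r \<subseteq> K"
    and m: "\<And>x. x \<in> cball x0 r \<Longrightarrow> m \<le> g x"
  obtains l :: "'a \<Rightarrow>\<^sub>L real" and k where
    "\<And>x a. (x, a) \<in> A \<Longrightarrow> l x + k \<le> a" "\<And>x. x \<in> K \<Longrightarrow> g x \<le> l x + k"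
proof -
  define D where "D = (\<lambda>((x, a), (y, b)). (x - y, a + b)) ` (A \<times> epigraph K (\<lambda>y. - g y))"
  have D_I: "(x - y, a + b) \<in> D" if "(x, a) \<in> A" "y \<in> K" "- g y \<le> b" for x a y b
    unfolding D_def using that
    by (intro image_eqI[of _ _ "((x, a), (y, b))"]) (auto simp: mem_epigraph)
  have "linear (\<lambda>((x::'a, a::real), (y, b)). (x - y, a + b))"
    by (rule linearI) (auto simp: algebra_simps)
  then have "convex D"
    unfolding D_def using g
    by (intro convex_linear_image convex_Times A convex_epigraphI) (simp_all add: concave_on_def)
  moreover have "0 \<le> v" if "(0, v) \<in> D" for v
    using that below by (force simp: D_def mem_epigraph)
  moreover have "(x, a0 - m) \<in> D" if "norm x \<le> r" for x
  proof -
    have "x0 - x \<in> cball x0 r" using that by (simp add: dist_norm)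
    then show ?thesis using D_I[OF x0, of "x0 - x" "- m"] r(2) m by force
  qed
  ultimately obtain l :: "'a \<Rightarrow>\<^sub>L real" where l: "\<And>x v. (x, v) \<in> D \<Longrightarrow> l x \<le> v"
    using convex_set_continuous_linear_minorant[OF _ _ r(1)] by metis
  have separated: "g y - l y \<le> snd p - l (fst p)" if "p \<in> A" "y \<in> K" for p y
    using l[OF D_I[of "fst p" "snd p" y "- g y"]] that by (simp add: blinfun.diff_right)
  have "x0 \<in> K" using r by auto
  then obtain k where k_upper: "\<And>y. y \<in> K \<Longrightarrow> g y - l y \<le> k"
    and k_lower: "\<And>p. p \<in> A \<Longrightarrow> k \<le> snd p - l (fst p)"
    using real_valued_separation[of K A "\<lambda>y. g y - l y" "\<lambda>p. snd p - l (fst p)"] separated x0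
    by (metis empty_iff)
  show thesis
  proof (rule that)
    show "l x + k \<le> a" if "(x, a) \<in> A" for x a
      using k_lower[OF that] by simp
    show "g x \<le> l x + k" if "x \<in> K" for x
      using k_upper[OF that] by simp
  qed
qed

section \<open>The coupling of a space with its dual\<close>

definition coupling :: "'a::real_normed_vector \<times> ('a \<Rightarrow>\<^sub>L real) \<Rightarrow> real" where
  "coupling b = snd b (fst b)"

definition pairing ::
  "'a::real_normed_vector \<times> ('a \<Rightarrow>\<^sub>L real) \<Rightarrow> 'a \<times> ('a \<Rightarrow>\<^sub>L real) \<Rightarrow> real" where
  "pairing b d = snd b (fst d) + snd d (fst b)"

definition regularized_coupling :: "'a::real_normed_vector \<times> ('a \<Rightarrow>\<^sub>L real) \<Rightarrow> real" where
  "regularized_coupling b = coupling b + (norm b)\<^sup>2 / 2"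

lemmas coupling_simps = coupling_def pairing_def blinfun.add_left blinfun.add_right
  blinfun.diff_left blinfun.diff_right blinfun.scaleR_left blinfun.scaleR_right

lemma coupling_add: "coupling (b + d) = coupling b + pairing b d + coupling d"
  by (simp add: coupling_simps)

lemma coupling_diff: "coupling (b - d) = coupling b - pairing b d + coupling d"
  by (simp add: coupling_simps)

lemma coupling_minus_commute: "coupling (s - t) = coupling (t - s)"
  by (simp add: coupling_simps)

lemma coupling_zero [simp]: "coupling 0 = 0"
  by (simp add: coupling_def)

lemma abs_pairing_le: "\<bar>pairing b d\<bar> \<le> norm b * norm d"
proof -
  have "\<bar>pairing b d\<bar> \<le> norm (snd b) * norm (fst d) + norm (fst b) * norm (snd d)"
    unfolding pairing_def
    using norm_blinfun[of "snd b" "fst d"] norm_blinfun[of "snd d" "fst b"]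
    by (simp add: mult.commute)
  also have "\<dots> = (norm (snd b), norm (fst b)) \<bullet> (norm (fst d), norm (snd d))"
    by simp
  also have "\<dots> \<le> norm (norm (snd b), norm (fst b)) * norm (norm (fst d), norm (snd d))"
    by (rule norm_cauchy_schwarz)
  also have "\<dots> = norm b * norm d"
    by (simp add: norm_Pair norm_prod_def add.commute)
  finally show ?thesis .
qed

lemma abs_coupling_le: "\<bar>coupling b\<bar> \<le> (norm b)\<^sup>2 / 2"
  using abs_pairing_le[of b b] by (simp add: coupling_def pairing_def power2_eq_square)

lemma regularized_coupling_nonneg: "0 \<le> regularized_coupling b"
  using abs_coupling_le[of b] by (simp add: regularized_coupling_def)

lemma regularized_coupling_add_le:
  "regularized_coupling (d + h) \<le> regularized_coupling d + 2 * norm d * norm h + (norm h)\<^sup>2"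
proof -
  have "(norm (d + h))\<^sup>2 \<le> (norm d + norm h)\<^sup>2" by (intro power_mono norm_triangle_ineq) simp
  then have "(norm (d + h))\<^sup>2 / 2 \<le> (norm d)\<^sup>2 / 2 + norm d * norm h + (norm h)\<^sup>2 / 2"
    by (simp add: power2_sum)
  then show ?thesis
    using abs_pairing_le[of d h] abs_coupling_le[of h]
    unfolding regularized_coupling_def coupling_add by linarith
qed

lemma continuous_on_coupling [continuous_intros]:
  "continuous_on S f \<Longrightarrow> continuous_on S (\<lambda>x. coupling (f x))"
  unfolding coupling_def by (intro continuous_intros)

section \<open>Fenchel duality with half the squared norm\<close>

lemma convex_on_linear:
  assumes "linear f" "convex S"
  shows "convex_on S f"
  using assms by (simp add: convex_on_def linear_add linear_scale)

lemma convex_on_norm: "convex S \<Longrightarrow> convex_on S norm"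
  using convex_on_dist[of S 0] by simp

lemma convex_on_norm_square:
  fixes S :: "'a::real_normed_vector set"
  assumes "convex S"
  shows "convex_on S (\<lambda>x. (norm x)\<^sup>2)"
  unfolding convex_on_def
proof (intro conjI ballI allI impI)
  fix x y :: 'a and u v :: real
  assume "x \<in> S" "y \<in> S" and uv: "0 \<le> u" "0 \<le> v" "u + v = 1"
  then have "(norm (u *\<^sub>R x + v *\<^sub>R y))\<^sup>2 \<le> (u * norm x + v * norm y)\<^sup>2"
    using convex_on_norm[OF assms] by (intro power_mono) (simp_all add: convex_on_def)
  also have "\<dots> \<le> u * (norm x)\<^sup>2 + v * (norm y)\<^sup>2"
    using convex_power2 uv by (simp add: convex_on_def)
  finally show "(norm (u *\<^sub>R x + v *\<^sub>R y))\<^sup>2 \<le> u * (norm x)\<^sup>2 + v * (norm y)\<^sup>2" .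
qed fact

lemma abs_blinfun_le_half_norm_squares:
  fixes f :: "'a::real_normed_vector \<Rightarrow>\<^sub>L real"
  shows "\<bar>f x\<bar> \<le> (norm f)\<^sup>2 / 2 + (norm x)\<^sup>2 / 2"
proof -
  have "\<bar>f x\<bar> \<le> norm f * norm x" using norm_blinfun[of f x] by simp
  also have "\<dots> \<le> (norm f)\<^sup>2 / 2 + (norm x)\<^sup>2 / 2"
    using sum_squares_bound[of "norm f" "norm x"] by simp
  finally show ?thesis .
qed

lemma blinfun_unit_vector_above:
  fixes f :: "'a::real_normed_vector \<Rightarrow>\<^sub>L real"
  assumes "0 \<le> c" "c < norm f"
  obtains x where "norm x = 1" "c < f x"
proof -
  obtain x where x: "c * norm x < \<bar>f x\<bar>"
    using norm_blinfun_bound[of c f] assms by (metis not_le real_norm_def)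
  then have "x \<noteq> 0" by auto
  have "0 \<le> c * norm x" using assms by simp
  then have "f x \<noteq> 0" using x by linarith
  show thesis
  proof (rule that)
    show "norm ((sgn (f x) / norm x) *\<^sub>R x) = 1"
      using \<open>x \<noteq> 0\<close> \<open>f x \<noteq> 0\<close> by (simp add: abs_sgn_eq)
    show "c < f ((sgn (f x) / norm x) *\<^sub>R x)"
      using x \<open>x \<noteq> 0\<close> by (simp add: blinfun.scaleR_right pos_less_divide_eq abs_sgn mult.commute)
  qed
qed

lemma half_norm_square_near_minimizer:
  fixes f :: "'a::real_normed_vector \<Rightarrow>\<^sub>L real"
  assumes "\<eta> > 0"
  obtains u where "(norm u)\<^sup>2 / 2 + f u \<le> - (norm f)\<^sup>2 / 2 + \<eta>"
proof (cases "(norm f)\<^sup>2 \<le> 2 * \<eta>")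
  case True
  then show ?thesis by (intro that[of 0]) simp
next
  case False
  define c where "c = sqrt ((norm f)\<^sup>2 - 2 * \<eta>)"
  have "0 \<le> (norm f)\<^sup>2 - 2 * \<eta>" using False by linarith
  then have c2: "c\<^sup>2 = (norm f)\<^sup>2 - 2 * \<eta>" and "0 \<le> c"
    unfolding c_def by (rule real_sqrt_pow2, rule real_sqrt_ge_zero)
  have "c\<^sup>2 < (norm f)\<^sup>2" using c2 assms by linarith
  then have "c < norm f" by (rule power2_less_imp_less) simp
  with \<open>0 \<le> c\<close> obtain x where "norm x = 1" "c < f x" by (rule blinfun_unit_vector_above)
  moreover have "c * c \<le> c * f x" using \<open>c < f x\<close> \<open>0 \<le> c\<close> by (intro mult_left_mono) simp_all
  ultimately have "(norm (- c *\<^sub>R x))\<^sup>2 / 2 + f (- c *\<^sub>R x) \<le> - c\<^sup>2 / 2"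
    by (simp add: blinfun.minus_right blinfun.scaleR_right power2_eq_square)
  then show ?thesis using c2 by (intro that[of "- c *\<^sub>R x"]) simp
qed

lemma convex_plus_half_norm_square_less:
  fixes A :: "('a::real_normed_vector \<times> real) set"
  assumes A: "convex A" "A \<noteq> {}"
    and dual: "\<And>l :: 'a \<Rightarrow>\<^sub>L real. \<exists>(x, a)\<in>A. a < blinfun_apply l x + (norm l)\<^sup>2 / 2 + \<epsilon>"
  obtains x a where "(x, a) \<in> A" "a + (norm x)\<^sup>2 / 2 < \<epsilon>"
proof -
  have "\<exists>(x, a)\<in>A. a + (norm x)\<^sup>2 / 2 < \<epsilon>"
  proof (rule ccontr)
    assume "\<not> ?thesis"
    then have above: "\<epsilon> - (norm x)\<^sup>2 / 2 \<le> a" if "(x, a) \<in> A" for x a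
      using that by force
    obtain x0 a0 where x0: "(x0, a0) \<in> A" using A(2) by auto
    have concave: "concave_on UNIV (\<lambda>x::'a. \<epsilon> - (norm x)\<^sup>2 / 2)"
      by (intro concave_on_diff concave_on_const[THEN iffD2] convex_on_cdiv convex_on_norm_square)
        simp_all
    have bounded: "\<epsilon> - (norm x0 + 1)\<^sup>2 / 2 \<le> \<epsilon> - (norm x)\<^sup>2 / 2" if "x \<in> cball x0 1" for x
    proof -
      have "norm x \<le> norm x0 + 1" 
        using that norm_triangle_sub[of x x0] by (simp add: dist_norm norm_minus_commute[of x0])
      then show ?thesis by (simp add: power_mono)
    qed
    obtain l k where l_le: "\<And>x a. (x, a) \<in> A \<Longrightarrow> blinfun_apply l x + k \<le> a"
      and l_ge: "\<And>x. x \<in> UNIV \<Longrightarrow> \<epsilon> - (norm x)\<^sup>2 / 2 \<le> blinfun_apply l x + k"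
      using convex_sandwich[OF A(1) concave above x0 zero_less_one subset_UNIV bounded] by blast
    have "\<epsilon> + (norm l)\<^sup>2 / 2 \<le> k"
    proof (rule field_le_epsilon)
      fix \<eta> :: real assume "\<eta> > 0"
      then obtain u where "(norm u)\<^sup>2 / 2 + l u \<le> - (norm l)\<^sup>2 / 2 + \<eta>"
        by (rule half_norm_square_near_minimizer)
      then show "\<epsilon> + (norm l)\<^sup>2 / 2 \<le> k + \<eta>" using l_ge[of u] by simp
    qed
    then show False using dual[of l] l_le by fastforce
  qed
  then show thesis using that by auto
qed

lemma blinfun_prod_split:
  fixes l :: "('a::real_normed_vector \<times> 'b::real_normed_vector) \<Rightarrow>\<^sub>L real"
  obtains l1 :: "'a \<Rightarrow>\<^sub>L real" and l2 :: "'b \<Rightarrow>\<^sub>L real" where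
    "\<And>x y. l (x, y) = l1 x + l2 y" "(norm l1)\<^sup>2 + (norm l2)\<^sup>2 \<le> (norm l)\<^sup>2"
proof -
  have "bounded_linear (\<lambda>x. l (x, 0))" "bounded_linear (\<lambda>y. l (0, y))"
    by (intro bounded_linear_compose[OF blinfun.bounded_linear_right]
        bounded_linear_Pair bounded_linear_ident bounded_linear_zero)+
  then obtain l1 l2 where
    parts: "\<And>x. blinfun_apply l1 x = l (x, 0)" "\<And>y. blinfun_apply l2 y = l (0, y)"
    by (metis bounded_linear_Blinfun_apply)
  have split: "l (x, y) = l1 x + l2 y" for x y
    using blinfun.add_right[of l "(x, 0)" "(0, y)"] by (simp add: parts)
  moreover have "(norm l1)\<^sup>2 + (norm l2)\<^sup>2 \<le> (norm l)\<^sup>2"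
  proof (rule field_le_epsilon)
    fix \<eta> :: real assume "\<eta> > 0"
    then have "\<eta> / 4 > 0" by simp
    obtain u where u: "(norm u)\<^sup>2 / 2 + l1 u \<le> - (norm l1)\<^sup>2 / 2 + \<eta> / 4"
      using half_norm_square_near_minimizer[OF \<open>\<eta> / 4 > 0\<close>] .
    obtain v where v: "(norm v)\<^sup>2 / 2 + l2 v \<le> - (norm l2)\<^sup>2 / 2 + \<eta> / 4"
      using half_norm_square_near_minimizer[OF \<open>\<eta> / 4 > 0\<close>] .
    have "- (norm l)\<^sup>2 / 2 \<le> (norm (u, v))\<^sup>2 / 2 + l (u, v)"
      using abs_blinfun_le_half_norm_squares[of l "(u, v)"] by linarith
    also have "\<dots> = ((norm u)\<^sup>2 / 2 + l1 u) + ((norm v)\<^sup>2 / 2 + l2 v)"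
      by (simp add: split norm_Pair add_divide_distrib)
    finally show "(norm l1)\<^sup>2 + (norm l2)\<^sup>2 \<le> (norm l)\<^sup>2 + \<eta>" using u v by simp
  qed
  ultimately show thesis by (rule that)
qed

text \<open>A encodes a convex function: it lies between the strict and the full epigraph.\<close>
definition conjugate_ge_coupling ::
  "(('a::real_normed_vector \<times> ('a \<Rightarrow>\<^sub>L real)) \<times> real) set \<Rightarrow> bool" where
  "conjugate_ge_coupling A \<longleftrightarrow>
     (\<forall>(v' :: 'a \<Rightarrow>\<^sub>L real) (v'' :: ('a \<Rightarrow>\<^sub>L real) \<Rightarrow>\<^sub>L real). \<forall>\<delta>>0.
       \<exists>((y, y'), a)\<in>A.
         a < blinfun_apply v' y + blinfun_apply v'' y' - blinfun_apply v'' v' + \<delta>)"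

lemma conjugate_ge_coupling_plus_half_norm_square_less:
  fixes A :: "(('a::real_normed_vector \<times> ('a \<Rightarrow>\<^sub>L real)) \<times> real) set"
  assumes "convex A" and conj: "conjugate_ge_coupling A" and "\<epsilon> > 0"
  obtains b a where "(b, a) \<in> A" "a + (norm b)\<^sup>2 / 2 < \<epsilon>"
proof -
  have "A \<noteq> {}" using conj[unfolded conjugate_ge_coupling_def, rule_format, of 1] by auto
  moreover have "\<exists>(b, a)\<in>A. a < blinfun_apply l b + (norm l)\<^sup>2 / 2 + \<epsilon>" for l
  proof -
    obtain v' v'' where
      split: "\<And>y y'. blinfun_apply l (y, y') = blinfun_apply v' y + blinfun_apply v'' y'"
      and norms: "(norm v')\<^sup>2 + (norm v'')\<^sup>2 \<le> (norm l)\<^sup>2"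
      using blinfun_prod_split[of l] by blast
    obtain y y' a where "((y, y'), a) \<in> A" "a < v' y + v'' y' - v'' v' + \<epsilon>"
      using conj \<open>\<epsilon> > 0\<close> unfolding conjugate_ge_coupling_def by blast
    then show ?thesis
      using abs_blinfun_le_half_norm_squares[of v'' v'] norms
      by (intro bexI[of _ "((y, y'), a)"]) (simp_all add: split)
  qed
  ultimately show thesis
    using convex_plus_half_norm_square_less[OF \<open>convex A\<close>, of \<epsilon>] that by blast
qed

definition dominated_functionals :: "('a::real_normed_vector \<times> real) set \<Rightarrow> ('a \<Rightarrow>\<^sub>L real) set" where
  "dominated_functionals \<Sigma> = {v. \<forall>(z, r)\<in>\<Sigma>. blinfun_apply v z \<le> r}"

lemma convex_dominated_functionals: "convex (dominated_functionals \<Sigma>)"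
  by (rule convexI)
    (auto simp: dominated_functionals_def blinfun.add_left blinfun.scaleR_left
      intro!: convex_bound_le)

lemma dominated_functionalsI_bounded:
  assumes \<Sigma>: "convex_cone \<Sigma>" and bound: "\<And>z r. (z, r) \<in> \<Sigma> \<Longrightarrow> blinfun_apply v z - r \<le> C"
  shows "v \<in> dominated_functionals \<Sigma>"
proof -
  have "v z \<le> r" if "(z, r) \<in> \<Sigma>" for z r
  proof (rule ccontr)
    define t where "t = (\<bar>C\<bar> + 1) / (v z - r)"
    assume "\<not> v z \<le> r"
    then have "t \<ge> 0" "t * (v z - r) = \<bar>C\<bar> + 1" by (simp_all add: t_def)
    moreover have "t * (v z - r) \<le> C"
      using bound[of "t *\<^sub>R z" "t * r"] convex_cone_scaleR[OF \<Sigma> \<open>t \<ge> 0\<close> that]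
      by (simp add: blinfun.scaleR_right algebra_simps)
    ultimately show False by simp
  qed
  then show ?thesis by (auto simp: dominated_functionals_def)
qed

text \<open>Restriction to the dominated functionals K in the dual variable and inf-convolution with the
  support function of K in the primal variable; \<open>\<Sigma>\<close> is the epigraph of that support function.\<close>
definition localized_epi ::
  "('a::real_normed_vector \<times> real) set \<Rightarrow> (('a \<times> ('a \<Rightarrow>\<^sub>L real)) \<times> real) set
    \<Rightarrow> (('a \<times> ('a \<Rightarrow>\<^sub>L real)) \<times> real) set" where
  "localized_epi \<Sigma> F = {((u + z, y'), a + r) |u z y' a r.
     ((u, y'), a) \<in> F \<and> y' \<in> dominated_functionals \<Sigma> \<and> (z, r) \<in> \<Sigma>}"

lemma convex_localized_epi:
  assumes "convex F" "convex \<Sigma>"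
  shows "convex (localized_epi \<Sigma> F)"
proof -
  define T where "T = (\<lambda>(((u::'a, y'::'a \<Rightarrow>\<^sub>L real), a::real), (z, r)). ((u + z, y'), a + r))"
  have "localized_epi \<Sigma> F = T ` ((F \<inter> (snd \<circ> fst) -` dominated_functionals \<Sigma>) \<times> \<Sigma>)"
    by (force simp: localized_epi_def T_def image_iff)
  also have "convex \<dots>"
  proof (intro convex_linear_image convex_Times convex_Int convex_linear_vimage linear_compose
      linear_fst linear_snd convex_dominated_functionals assms)
    show "linear T" by (rule linearI) (auto simp: T_def algebra_simps)
  qed
  finally show ?thesis .
qed

lemma conjugate_ge_coupling_localized_epi:
  assumes F: "convex F" "conjugate_ge_coupling F" and \<Sigma>: "convex_cone \<Sigma>"
    and b0: "((x0, y0), a0) \<in> F" and \<eta>: "\<eta> > 0" "cball y0 \<eta> \<subseteq> dominated_functionals \<Sigma>"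
  shows "conjugate_ge_coupling (localized_epi \<Sigma> F)"
  unfolding conjugate_ge_coupling_def
proof (intro allI impI, rule ccontr)
  fix v' :: "'a \<Rightarrow>\<^sub>L real" and v'' :: "('a \<Rightarrow>\<^sub>L real) \<Rightarrow>\<^sub>L real" and \<delta> :: real
  assume "\<delta> > 0"
    and none: "\<not> (\<exists>((y, y'), a)\<in>localized_epi \<Sigma> F.
      a < blinfun_apply v' y + blinfun_apply v'' y' - blinfun_apply v'' v' + \<delta>)"
  define K where "K = dominated_functionals \<Sigma>"
  have "y0 \<in> K" using \<eta> by (auto simp: K_def)
  have lower_bound: "v' (u + z) + v'' y' - v'' v' + \<delta> \<le> a + r"
    if "((u, y'), a) \<in> F" "y' \<in> K" "(z, r) \<in> \<Sigma>" for u y' a z r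
    using none that unfolding localized_epi_def K_def by (fastforce simp: not_less)
  have "v' z - r \<le> a0 - v' x0 - v'' y0 + v'' v' - \<delta>" if "(z, r) \<in> \<Sigma>" for z r
    using lower_bound[OF b0 \<open>y0 \<in> K\<close> that] by (simp add: blinfun.add_right)
  then have "v' \<in> K" unfolding K_def by (rule dominated_functionalsI_bounded[OF \<Sigma>])
  define A where "A = (\<lambda>((u, y'), a). (y', a - blinfun_apply v' u - blinfun_apply v'' y')) ` F"
  have A_I: "(y', a - v' u - v'' y') \<in> A" if "((u, y'), a) \<in> F" for u y' a
    unfolding A_def using that by force
  have "linear (\<lambda>((u, y'), a). (y', a - blinfun_apply v' u - blinfun_apply v'' y'))"
    by (rule linearI) (auto simp: blinfun.add_right blinfun.scaleR_right algebra_simps)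
  then have "convex A" unfolding A_def by (rule convex_linear_image[OF _ F(1)])
  have concave: "concave_on K (\<lambda>y'. \<delta> - v'' v')"
    unfolding K_def by (simp add: concave_on_const convex_dominated_functionals)
  have above: "\<delta> - v'' v' \<le> a" if "(y', a) \<in> A" "y' \<in> K" for y' a
    using that lower_bound[of _ _ _ 0 0] convex_cone_contains_0[OF \<Sigma>]
    by (fastforce simp: A_def zero_prod_def)
  have "cball y0 \<eta> \<subseteq> K" using \<eta>(2) by (simp add: K_def)
  obtain l k where l_le: "\<And>y' a. (y', a) \<in> A \<Longrightarrow> blinfun_apply l y' + k \<le> a"
    and l_ge: "\<And>y'. y' \<in> K \<Longrightarrow> \<delta> - v'' v' \<le> blinfun_apply l y' + k"
    using convex_sandwich[OF \<open>convex A\<close> concave _ A_I[OF b0] \<eta>(1) \<open>cball y0 \<eta> \<subseteq> K\<close> order_refl]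
      above by blast
  \<comment> \<open>l is a multiplier of the constraint in K and is absorbed into the bidual variable\<close>
  obtain y y' a where below_multiplier: "((y, y'), a) \<in> F" "a < v' y + (v'' + l) y' - (v'' + l) v' + \<delta>"
    using F(2) \<open>\<delta> > 0\<close> unfolding conjugate_ge_coupling_def by blast
  show False
    using l_le[OF A_I[OF below_multiplier(1)]] l_ge[OF \<open>v' \<in> K\<close>] below_multiplier(2) by (simp add: blinfun.add_left)
qed

section \<open>Enlargements of a maximally monotone graph\<close>

definition enlargement ::
  "('a::real_normed_vector \<times> ('a \<Rightarrow>\<^sub>L real)) set \<Rightarrow> real \<Rightarrow> ('a \<times> ('a \<Rightarrow>\<^sub>L real)) set" where
  "enlargement G \<epsilon> = {b. \<forall>s\<in>G. - \<epsilon> \<le> coupling (s - b)}"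

lemma enlargementD: "b \<in> enlargement G \<epsilon> \<Longrightarrow> s \<in> G \<Longrightarrow> - \<epsilon> \<le> coupling (s - b)"
  by (simp add: enlargement_def)

lemma enlargement_mono: "\<epsilon> \<le> \<epsilon>' \<Longrightarrow> enlargement G \<epsilon> \<subseteq> enlargement G \<epsilon>'"
  by (fastforce simp: enlargement_def)

lemma monotone_mf_iff: "monotone_mf G \<longleftrightarrow> (\<forall>s\<in>G. \<forall>t\<in>G. 0 \<le> coupling (s - t))"
  by (fastforce simp: monotone_mf_def coupling_def)

lemma maximally_monotone_enlargement_zero:
  assumes "maximally_monotone G"
  shows "enlargement G 0 = G"
proof
  have mono: "0 \<le> coupling (s - t)" if "s \<in> G" "t \<in> G" for s t
    using assms that by (simp add: maximally_monotone_def monotone_mf_iff)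
  then show "G \<subseteq> enlargement G 0" by (auto simp: enlargement_def)
  show "enlargement G 0 \<subseteq> G"
  proof
    fix b assume "b \<in> enlargement G 0"
    then have "monotone_mf (insert b G)"
      using mono by (auto simp: enlargement_def monotone_mf_iff coupling_minus_commute[of b])
    then have "insert b G = G" using assms unfolding maximally_monotone_def by blast
    then show "b \<in> G" by blast
  qed
qed

lemma maximally_monotone_exists_coupling_less:
  assumes "maximally_monotone G" "\<delta> > 0"
  obtains s where "s \<in> G" "coupling (s - b) < \<delta>"
proof (cases "b \<in> G")
  case True then show ?thesis using assms(2) by (intro that[of b]) auto
next
  case False
  then obtain s where "s \<in> G" "coupling (s - b) < 0"
    using maximally_monotone_enlargement_zero[OF assms(1)] by (force simp: enlargement_def)
  then show ?thesis using assms(2) by (intro that[of s]) auto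
qed

lemma enlargement_nonneg:
  assumes "maximally_monotone G" "b \<in> enlargement G \<epsilon>"
  shows "0 \<le> \<epsilon>"
proof (rule ccontr)
  assume "\<not> 0 \<le> \<epsilon>"
  then obtain s where "s \<in> G" "coupling (s - b) < - \<epsilon>"
    using maximally_monotone_exists_coupling_less[OF assms(1), of "- \<epsilon>" b] by auto
  then show False using enlargementD[OF assms(2)] by fastforce
qed

text \<open>Compare both points with their midpoint.\<close>
lemma enlargement_coupling_ge:
  assumes G: "maximally_monotone G" and b: "b \<in> enlargement G \<epsilon>" and b': "b' \<in> enlargement G \<epsilon>'"
  shows "- 2 * (\<epsilon> + \<epsilon>') \<le> coupling (b - b')"
proof (rule field_le_epsilon)
  fix \<delta> :: real assume "\<delta> > 0"
  define m where "m = (1/2) *\<^sub>R (b + b')"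
  obtain s where s: "s \<in> G" "coupling (s - m) < \<delta> / 4"
    using maximally_monotone_exists_coupling_less[OF G, of "\<delta> / 4" m] \<open>\<delta> > 0\<close> by auto
  have "coupling (s - m) = coupling (s - b) / 2 + coupling (s - b') / 2 - coupling (b - b') / 4"
    by (simp add: m_def coupling_simps field_simps)
  then show "- 2 * (\<epsilon> + \<epsilon>') \<le> coupling (b - b') + \<delta>"
    using s enlargementD[OF b s(1)] enlargementD[OF b' s(1)] by (simp add: field_simps)
qed

lemma enlargement_limit_mem:
  assumes G: "maximally_monotone G" and f: "f \<longlonglongrightarrow> b" and "\<epsilon> \<longlonglongrightarrow> 0"
    and enl: "\<And>n. f n \<in> enlargement G (\<epsilon> n)"
  shows "b \<in> G"
proof -
  have "0 \<le> coupling (s - b)" if "s \<in> G" for s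
  proof (rule LIMSEQ_le)
    show "(\<lambda>n. coupling (s - f n)) \<longlonglongrightarrow> coupling (s - b)"
      using continuous_on_tendsto_compose[of UNIV "\<lambda>x. coupling (s - x)", OF _ f]
      by (simp add: continuous_intros)
    show "(\<lambda>n. - \<epsilon> n) \<longlonglongrightarrow> 0" using tendsto_minus[OF \<open>\<epsilon> \<longlonglongrightarrow> 0\<close>] by simp
    show "\<exists>N. \<forall>n\<ge>N. - \<epsilon> n \<le> coupling (s - f n)" using enlargementD[OF enl that] by blast
  qed
  then have "b \<in> enlargement G 0" by (simp add: enlargement_def)
  then show ?thesis using maximally_monotone_enlargement_zero[OF G] by simp
qed

lemma maximally_monotone_imp_closed:
  assumes "maximally_monotone G"
  shows "closed G"
  unfolding closed_sequential_limits
  using enlargement_limit_mem[OF assms _ tendsto_const]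
    maximally_monotone_enlargement_zero[OF assms] by blast

lemma enlargement_norm_diff_le:
  assumes "s \<in> G" "b \<in> enlargement G \<epsilon>" "regularized_coupling (b - c) \<le> \<epsilon>"
  shows "norm (b - c) \<le> norm (s - c) + sqrt ((norm (s - c))\<^sup>2 + 2 * \<bar>coupling (s - c)\<bar> + 4 * \<epsilon>)"
proof -
  define d where "d = b - c"
  have "- \<epsilon> \<le> coupling ((s - c) - d)" using enlargementD[OF assms(2,1)] by (simp add: d_def)
  also have "\<dots> \<le> \<bar>coupling (s - c)\<bar> + norm (s - c) * norm d + coupling d"
    using abs_pairing_le[of "s - c" d] unfolding coupling_diff[of "s - c" d] by linarith
  finally have "(norm d)\<^sup>2 / 2 \<le> 2 * \<epsilon> + \<bar>coupling (s - c)\<bar> + norm (s - c) * norm d"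
    using assms(3) unfolding regularized_coupling_def d_def by linarith
  then have "(norm d - norm (s - c))\<^sup>2 \<le> (norm (s - c))\<^sup>2 + 2 * \<bar>coupling (s - c)\<bar> + 4 * \<epsilon>"
    by (simp add: power2_diff algebra_simps)
  then show ?thesis using real_le_rsqrt unfolding d_def by fastforce
qed

section \<open>The Fitzpatrick function\<close>

text \<open>The epigraph of the Fitzpatrick function of the translate of G by -c.\<close>
definition fitzpatrick_epi ::
  "('a::real_normed_vector \<times> ('a \<Rightarrow>\<^sub>L real)) set \<Rightarrow> 'a \<times> ('a \<Rightarrow>\<^sub>L real)
    \<Rightarrow> (('a \<times> ('a \<Rightarrow>\<^sub>L real)) \<times> real) set" where
  "fitzpatrick_epi G c = {(d, a). \<forall>s\<in>G. pairing (s - c) d - coupling (s - c) \<le> a}"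

lemma fitzpatrick_epi_iff_enlargement:
  "(d, a) \<in> fitzpatrick_epi G c \<longleftrightarrow> c + d \<in> enlargement G (a - coupling d)"
proof -
  have "coupling (s - (c + d)) = coupling (s - c) - pairing (s - c) d + coupling d" for s
    using coupling_diff[of "s - c" d] by (simp add: algebra_simps)
  then have "pairing (s - c) d - coupling (s - c) \<le> a
      \<longleftrightarrow> - (a - coupling d) \<le> coupling (s - (c + d))" for s
    by auto
  then show ?thesis by (simp add: fitzpatrick_epi_def enlargement_def)
qed

lemma graph_in_fitzpatrick_epi:
  assumes "maximally_monotone G" "s \<in> G"
  shows "(s - c, coupling (s - c)) \<in> fitzpatrick_epi G c"
  using assms by (simp add: fitzpatrick_epi_iff_enlargement maximally_monotone_enlargement_zero)

lemma linear_pairing: "linear (pairing b)"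
  by (rule linearI) (simp_all add: coupling_simps algebra_simps)

lemma convex_fitzpatrick_epi: "convex (fitzpatrick_epi G c)"
proof -
  have "fitzpatrick_epi G c = (\<Inter>s\<in>G. epigraph UNIV (\<lambda>d. pairing (s - c) d - coupling (s - c)))"
    by (auto simp: fitzpatrick_epi_def epigraph_def)
  also have "convex \<dots>"
    by (intro convex_INT convex_epigraphI convex_on_diff convex_on_linear linear_pairing
        concave_on_const[THEN iffD2] convex_UNIV)
  finally show ?thesis .
qed

section \<open>Negative infimum and quasidensity\<close>

text \<open>Gossez' condition of negative infimum: statement (c) without extended reals.\<close>
definition type_NI :: "('a::real_normed_vector \<times> ('a \<Rightarrow>\<^sub>L real)) set \<Rightarrow> bool" where
  "type_NI G \<longleftrightarrow> (\<forall>(w' :: 'a \<Rightarrow>\<^sub>L real) (w'' :: ('a \<Rightarrow>\<^sub>L real) \<Rightarrow>\<^sub>L real). \<forall>\<epsilon>>0.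
     \<exists>p\<in>G. blinfun_apply (canon (fst p) - w'') (snd p - w') < \<epsilon>)"

lemma canon_apply [simp]: "blinfun_apply (canon s) x' = blinfun_apply x' s"
  unfolding canon_def by (simp add: bounded_linear_Blinfun_apply blinfun.bounded_linear_left)

lemma INF_ereal_le_zero_iff:
  "(INF p\<in>G. ereal (f p)) \<le> 0 \<longleftrightarrow> (\<forall>\<epsilon>>0. \<exists>p\<in>G. f p < \<epsilon>)"
proof
  assume "(INF p\<in>G. ereal (f p)) \<le> 0"
  then have "(INF p\<in>G. ereal (f p)) < ereal \<epsilon>" if "\<epsilon> > 0" for \<epsilon>
    using that by (simp add: order_le_less_trans)
  then show "\<forall>\<epsilon>>0. \<exists>p\<in>G. f p < \<epsilon>" by (auto simp: INF_less_iff)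
next
  assume small: "\<forall>\<epsilon>>0. \<exists>p\<in>G. f p < \<epsilon>"
  show "(INF p\<in>G. ereal (f p)) \<le> 0"
  proof (rule ereal_le_epsilon2)
    fix \<epsilon> :: real assume "\<epsilon> > 0"
    then obtain p where "p \<in> G" "f p < \<epsilon>" using small by blast
    then show "(INF p\<in>G. ereal (f p)) \<le> 0 + ereal \<epsilon>"
      by (intro INF_lower2[of p]) auto
  qed
qed

lemma quasidense_iff: "quasidense G \<longleftrightarrow> (\<forall>c. \<forall>\<epsilon>>0. \<exists>s\<in>G. regularized_coupling (s - c) < \<epsilon>)"
  unfolding quasidense_def INF_ereal_le_zero_iff regularized_coupling_def
  by (simp add: coupling_def norm_prod_def add_divide_distrib algebra_simps split_paired_All)

lemma quasidense_imp_type_NI: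
  assumes "quasidense G"
  shows "type_NI G"
  unfolding type_NI_def
proof (intro allI impI)
  fix w' :: "'a \<Rightarrow>\<^sub>L real" and w'' :: "('a \<Rightarrow>\<^sub>L real) \<Rightarrow>\<^sub>L real" and \<epsilon> :: real
  assume "\<epsilon> > 0"
  then have "\<epsilon> / 2 > 0" by simp
  obtain y' where y': "(norm y')\<^sup>2 / 2 + w'' y' \<le> - (norm w'')\<^sup>2 / 2 + \<epsilon> / 2"
    using half_norm_square_near_minimizer[OF \<open>\<epsilon> / 2 > 0\<close>] .
  obtain s s' where "(s, s') \<in> G" "regularized_coupling ((s, s') - (0, w' - y')) < \<epsilon> / 2"
    using assms \<open>\<epsilon> / 2 > 0\<close> unfolding quasidense_iff by (metis surj_pair)
  moreover define d where "d = s' - (w' - y')"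
  ultimately have "d s + (norm s)\<^sup>2 / 2 + (norm d)\<^sup>2 / 2 < \<epsilon> / 2"
    by (simp add: regularized_coupling_def coupling_def norm_Pair add_divide_distrib)
  then have "blinfun_apply (canon s - w'') (d - y') < \<epsilon>"
    using y' abs_blinfun_le_half_norm_squares[of y' s] abs_blinfun_le_half_norm_squares[of w'' d]
    by (simp add: blinfun.diff_left blinfun.diff_right)
  moreover have "s' - w' = d - y'" by (simp add: d_def)
  ultimately show "\<exists>p\<in>G. blinfun_apply (canon (fst p) - w'') (snd p - w') < \<epsilon>"
    using \<open>(s, s') \<in> G\<close> by (intro bexI[of _ "(s, s')"]) simp_all
qed

lemma type_NI_conjugate_fitzpatrick:
  assumes G: "maximally_monotone G" and NI: "type_NI G"
  shows "conjugate_ge_coupling (fitzpatrick_epi G c)"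
  unfolding conjugate_ge_coupling_def
proof (intro allI impI)
  fix v' :: "'a \<Rightarrow>\<^sub>L real" and v'' :: "('a \<Rightarrow>\<^sub>L real) \<Rightarrow>\<^sub>L real" and \<delta> :: real
  assume "\<delta> > 0"
  then obtain s where s: "s \<in> G"
    "blinfun_apply (canon (fst s) - (canon (fst c) + v'')) (snd s - (snd c + v')) < \<delta>"
    using NI unfolding type_NI_def by blast
  then have "coupling (s - c) < v' (fst (s - c)) + v'' (snd (s - c)) - v'' v' + \<delta>"
    by (simp add: coupling_simps algebra_simps)
  then show "\<exists>((y, y'), a)\<in>fitzpatrick_epi G c.
      a < blinfun_apply v' y + blinfun_apply v'' y' - blinfun_apply v'' v' + \<delta>"
    using graph_in_fitzpatrick_epi[OF G s(1), of c]
    by (intro bexI[of _ "(s - c, coupling (s - c))"]) (simp_all add: split_beta)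
qed

lemma type_NI_enlargement_near:
  assumes G: "maximally_monotone G" and NI: "type_NI G" and "\<epsilon> > 0"
  obtains b where "b \<in> enlargement G \<epsilon>" "regularized_coupling (b - c) < \<epsilon>"
proof -
  obtain d a where "(d, a) \<in> fitzpatrick_epi G c" and less: "a + (norm d)\<^sup>2 / 2 < \<epsilon>"
    using conjugate_ge_coupling_plus_half_norm_square_less[OF convex_fitzpatrick_epi
        type_NI_conjugate_fitzpatrick[OF G NI] \<open>\<epsilon> > 0\<close>] .
  then have enlarged: "c + d \<in> enlargement G (a - coupling d)"
    by (simp add: fitzpatrick_epi_iff_enlargement)
  have split: "(a - coupling d) + regularized_coupling d < \<epsilon>"
    using less by (simp add: regularized_coupling_def)
  show thesis
  proof (rule that)
    have "a - coupling d \<le> \<epsilon>" using split regularized_coupling_nonneg[of d] by linarith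
    then show "c + d \<in> enlargement G \<epsilon>" using enlarged enlargement_mono by blast
    show "regularized_coupling (c + d - c) < \<epsilon>"
      using split enlargement_nonneg[OF G enlarged] by simp
  qed
qed

lemma type_NI_enlargement_step:
  assumes G: "maximally_monotone G" and NI: "type_NI G" and \<tau>: "\<tau> > 0"
    and b: "b \<in> enlargement G (\<tau>\<^sup>2)"
  obtains b' where "b' \<in> enlargement G ((\<tau> / 2)\<^sup>2)" "norm (b' - b) \<le> 3 * \<tau>"
proof -
  obtain b' where b': "b' \<in> enlargement G ((\<tau> / 2)\<^sup>2)" "regularized_coupling (b' - b) < (\<tau> / 2)\<^sup>2"
    using type_NI_enlargement_near[OF G NI, of "(\<tau> / 2)\<^sup>2" b] \<tau> by auto
  have "- 2 * ((\<tau> / 2)\<^sup>2 + \<tau>\<^sup>2) \<le> coupling (b' - b)"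
    by (rule enlargement_coupling_ge[OF G b'(1) b])
  with b'(2) have "(norm (b' - b))\<^sup>2 \<le> 11 / 2 * \<tau>\<^sup>2"
    by (simp add: regularized_coupling_def power_divide)
  also have "\<dots> \<le> (3 * \<tau>)\<^sup>2" by (simp add: power_mult_distrib)
  finally have "norm (b' - b) \<le> 3 * \<tau>" by (rule power2_le_imp_le) (use \<tau> in simp)
  then show ?thesis using that[OF b'(1)] by simp
qed

lemma geometric_steps_convergent:
  fixes f :: "nat \<Rightarrow> 'a::banach"
  assumes step: "\<And>n. norm (f (Suc n) - f n) \<le> C / 2 ^ n"
  obtains l where "f \<longlonglongrightarrow> l" "norm (l - f 0) \<le> 2 * C"
proof -
  define g where "g n = f (Suc n) - f n" for n
  have majorant: "(\<lambda>n. C / 2 ^ n) sums (2 * C)"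
    using sums_mult[OF geometric_sums[of "1 / 2 :: real"], of C]
    by (simp add: power_divide mult.commute)
  have g_le: "norm (g n) \<le> C / 2 ^ n" for n using step by (simp add: g_def)
  have summable: "summable (\<lambda>n. norm (g n))"
    by (rule summable_comparison_test'[OF sums_summable[OF majorant], of 0]) (use g_le in auto)
  have "(\<lambda>n. \<Sum>i<n. g i) \<longlonglongrightarrow> suminf g"
    using summable_norm_cancel[OF summable] by (rule summable_LIMSEQ)
  then have "(\<lambda>n. f 0 + (f n - f 0)) \<longlonglongrightarrow> f 0 + suminf g"
    unfolding g_def sum_lessThan_telescope by (intro tendsto_intros)
  moreover have "norm (suminf g) \<le> 2 * C"
    using summable_norm[OF summable] suminf_le[OF g_le summable sums_summable[OF majorant]]
      sums_unique[OF majorant] by simp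
  ultimately show thesis by (intro that[of "f 0 + suminf g"]) simp_all
qed

text \<open>A Bronsted-Rockafellar property.\<close>
lemma type_NI_enlargement_close:
  fixes G :: "('a::banach \<times> ('a \<Rightarrow>\<^sub>L real)) set"
  assumes G: "maximally_monotone G" and NI: "type_NI G" and \<tau>: "\<tau> > 0"
    and b: "b \<in> enlargement G (\<tau>\<^sup>2)"
  obtains s where "s \<in> G" "norm (s - b) \<le> 6 * \<tau>"
proof -
  define P where "P n x \<longleftrightarrow> x \<in> enlargement G ((\<tau> / 2 ^ n)\<^sup>2) \<and> (n = 0 \<longrightarrow> x = b)" for n x
  have "\<exists>f. \<forall>n. P n (f n) \<and> norm (f (Suc n) - f n) \<le> 3 * (\<tau> / 2 ^ n)"
  proof (rule dependent_nat_choice)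
    show "\<exists>x. P 0 x" using b by (intro exI[of _ b]) (simp add: P_def)
    show "\<exists>y. P (Suc n) y \<and> norm (y - x) \<le> 3 * (\<tau> / 2 ^ n)" if "P n x" for x n
    proof -
      have "\<tau> / 2 ^ n > 0" "x \<in> enlargement G ((\<tau> / 2 ^ n)\<^sup>2)" using \<tau> that by (auto simp: P_def)
      then obtain y where "y \<in> enlargement G ((\<tau> / 2 ^ n / 2)\<^sup>2)" "norm (y - x) \<le> 3 * (\<tau> / 2 ^ n)"
        using type_NI_enlargement_step[OF G NI] by blast
      then show ?thesis by (intro exI[of _ y]) (simp add: P_def mult.commute)
    qed
  qed
  then obtain f where f: "\<And>n. f n \<in> enlargement G ((\<tau> / 2 ^ n)\<^sup>2)" "f 0 = b"
    and "\<And>n. norm (f (Suc n) - f n) \<le> 3 * \<tau> / 2 ^ n"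
    by (auto simp: P_def)
  then obtain s where s: "f \<longlonglongrightarrow> s" "norm (s - b) \<le> 2 * (3 * \<tau>)"
    using geometric_steps_convergent[of f "3 * \<tau>"] by blast
  have "(\<lambda>n. (\<tau> * (1 / 2) ^ n)\<^sup>2) \<longlonglongrightarrow> 0"
    by (auto intro!: tendsto_eq_intros LIMSEQ_power_zero)
  then have "(\<lambda>n. (\<tau> / 2 ^ n)\<^sup>2) \<longlonglongrightarrow> 0" by (simp add: power_divide)
  then have "s \<in> G" using enlargement_limit_mem[OF G s(1)] f(1) by blast
  then show thesis using s(2) by (intro that) simp_all
qed

lemma type_NI_imp_quasidense:
  fixes G :: "('a::banach \<times> ('a \<Rightarrow>\<^sub>L real)) set"
  assumes G: "maximally_monotone G" "G \<noteq> {}" and NI: "type_NI G"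
  shows "quasidense G"
  unfolding quasidense_iff
proof (intro allI impI)
  fix c and \<epsilon> :: real assume "\<epsilon> > 0"
  obtain s0 where "s0 \<in> G" using G by blast
  define M where "M = norm (s0 - c) + sqrt ((norm (s0 - c))\<^sup>2 + 2 * \<bar>coupling (s0 - c)\<bar> + 4)"
  define E where "E \<tau> = \<tau>\<^sup>2 + 2 * M * (6 * \<tau>) + (6 * \<tau>)\<^sup>2" for \<tau>
  have "(E \<longlongrightarrow> 0) (at_right 0)" unfolding E_def by (auto intro!: tendsto_eq_intros)
  then have "\<forall>\<^sub>F \<tau> in at_right 0. E \<tau> < \<epsilon>" by (rule order_tendstoD(2)[OF _ \<open>\<epsilon> > 0\<close>])
  then obtain \<tau> where \<tau>: "0 < \<tau>" "\<tau> < 1" "E \<tau> < \<epsilon>"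
    unfolding eventually_at_right_field by (metis dense min_less_iff_conj zero_less_one)
  then have "\<tau>\<^sup>2 \<le> 1" "0 < \<tau>\<^sup>2" by (simp_all add: power_le_one)
  obtain b where b: "b \<in> enlargement G (\<tau>\<^sup>2)" "regularized_coupling (b - c) < \<tau>\<^sup>2"
    using type_NI_enlargement_near[OF G(1) NI \<open>0 < \<tau>\<^sup>2\<close>] .
  have "norm (b - c) \<le> norm (s0 - c) + sqrt ((norm (s0 - c))\<^sup>2 + 2 * \<bar>coupling (s0 - c)\<bar> + 4 * 1)"
    using b \<open>\<tau>\<^sup>2 \<le> 1\<close> \<open>s0 \<in> G\<close> enlargement_mono[OF \<open>\<tau>\<^sup>2 \<le> 1\<close>, of G]
    by (intro enlargement_norm_diff_le) auto
  then have "norm (b - c) \<le> M" by (simp add: M_def)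
  obtain s where s: "s \<in> G" "norm (s - b) \<le> 6 * \<tau>"
    using type_NI_enlargement_close[OF G(1) NI \<tau>(1) b(1)] .
  have "regularized_coupling ((b - c) + (s - b))
      \<le> regularized_coupling (b - c) + 2 * norm (b - c) * norm (s - b) + (norm (s - b))\<^sup>2"
    by (rule regularized_coupling_add_le)
  also have "\<dots> \<le> \<tau>\<^sup>2 + 2 * M * (6 * \<tau>) + (6 * \<tau>)\<^sup>2"
    using b(2) s(2) \<open>norm (b - c) \<le> M\<close> norm_ge_zero[of "b - c"] norm_ge_zero[of "s - b"]
    by (intro add_mono mult_mono power_mono) linarith+
  also have "\<dots> < \<epsilon>" using \<tau>(3) by (simp add: E_def)
  finally show "\<exists>s\<in>G. regularized_coupling (s - c) < \<epsilon>"
    using s(1) by (intro bexI[of _ s]) simp_all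
qed

section \<open>Type (FP) and tubes around segments\<close>

definition segment_tube :: "'a::real_normed_vector \<Rightarrow> 'a \<Rightarrow> real \<Rightarrow> 'a set" where
  "segment_tube a b r = (\<Union>x\<in>closed_segment a b. ball x r)"

lemma segment_tube_iff:
  "x \<in> segment_tube a b r \<longleftrightarrow> (\<exists>t h. 0 \<le> t \<and> t \<le> 1 \<and> norm h < r \<and> x = a + t *\<^sub>R (b - a) + h)"
proof
  assume "x \<in> segment_tube a b r"
  then obtain t where t: "0 \<le> t" "t \<le> 1" "norm (x - ((1 - t) *\<^sub>R a + t *\<^sub>R b)) < r"
    by (auto simp: segment_tube_def in_segment dist_norm norm_minus_commute)
  then show "\<exists>t h. 0 \<le> t \<and> t \<le> 1 \<and> norm h < r \<and> x = a + t *\<^sub>R (b - a) + h"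
    by (intro exI[of _ t] exI[of _ "x - ((1 - t) *\<^sub>R a + t *\<^sub>R b)"]) (simp add: algebra_simps)
next
  assume "\<exists>t h. 0 \<le> t \<and> t \<le> 1 \<and> norm h < r \<and> x = a + t *\<^sub>R (b - a) + h"
  then obtain t h where t: "0 \<le> t" "t \<le> 1" and h: "norm h < r" and x: "x = a + t *\<^sub>R (b - a) + h"
    by blast
  have "a + t *\<^sub>R (b - a) = (1 - t) *\<^sub>R a + t *\<^sub>R b" by (simp add: algebra_simps)
  then have "a + t *\<^sub>R (b - a) \<in> closed_segment a b" using t by (auto simp: in_segment)
  moreover have "x \<in> ball (a + t *\<^sub>R (b - a)) r" using h by (simp add: x dist_norm)
  ultimately show "x \<in> segment_tube a b r" unfolding segment_tube_def by blast
qed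

lemma open_segment_tube: "open (segment_tube a b r)"
  by (auto simp: segment_tube_def)

lemma convex_segment_tube: "convex (segment_tube a b r)"
proof -
  have "segment_tube a b r = (\<Union>x\<in>closed_segment a b. \<Union>h\<in>ball 0 r. {x + h})"
    by (force simp: segment_tube_def dist_norm norm_minus_commute intro: rev_bexI[of "_ - _"])
  then show ?thesis by (simp add: convex_sums)
qed

lemma endpoints_in_segment_tube:
  assumes "r > 0"
  shows "a \<in> segment_tube a b r" "b \<in> segment_tube a b r"
  using assms by (force simp: segment_tube_def)+

lemma open_convex_contains_segment_tube:
  assumes "open U" "convex U" "a \<in> U" "b \<in> U"
  obtains r where "r > 0" "segment_tube a b r \<subseteq> U"
  using compact_subset_open_imp_ball_epsilon_subset[OF compact_segment \<open>open U\<close>]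
    closed_segment_subset[OF assms(3,4,2)] unfolding segment_tube_def by metis

lemma bidual_agrees_on_functional:
  fixes p :: "'a::real_normed_vector \<Rightarrow>\<^sub>L real" and w'' :: "('a \<Rightarrow>\<^sub>L real) \<Rightarrow>\<^sub>L real"
  obtains w where "blinfun_apply p w = blinfun_apply w'' p" "norm w \<le> 2 * norm w''"
proof (cases "p = 0")
  case True then show ?thesis by (intro that[of 0]) auto
next
  case False
  then obtain x where x: "norm x = 1" "norm p / 2 < p x"
    using blinfun_unit_vector_above[of "norm p / 2" p] by auto
  then have "p x > 0" using norm_ge_zero[of p] by linarith
  have "\<bar>w'' p\<bar> \<le> norm w'' * norm p" using norm_blinfun[of w'' p] by simp
  also have "\<dots> \<le> norm w'' * (2 * p x)" using x by (intro mult_left_mono) simp_all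
  finally have "norm ((w'' p / p x) *\<^sub>R x) \<le> 2 * norm w''"
    using x(1) \<open>p x > 0\<close> by (simp add: pos_divide_le_eq)
  then show ?thesis
    using \<open>p x > 0\<close> by (intro that[of "(w'' p / p x) *\<^sub>R x"]) (simp_all add: blinfun.scaleR_right)
qed

lemma bidual_near_point_on_segment_tube:
  fixes a b :: "'a::real_normed_vector \<Rightarrow>\<^sub>L real" and w'' :: "('a \<Rightarrow>\<^sub>L real) \<Rightarrow>\<^sub>L real"
  obtains w where
    "\<And>x r. x \<in> segment_tube a b r
      \<Longrightarrow> \<bar>blinfun_apply w'' (x - a) - blinfun_apply (x - a) w\<bar> \<le> 3 * norm w'' * r"
proof -
  obtain w where w: "blinfun_apply (b - a) w = blinfun_apply w'' (b - a)" "norm w \<le> 2 * norm w''"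
    using bidual_agrees_on_functional .
  have "\<bar>w'' (x - a) - (x - a) w\<bar> \<le> 3 * norm w'' * r" if "x \<in> segment_tube a b r" for x r
  proof -
    obtain t h where h: "norm h < r" and "x = a + t *\<^sub>R (b - a) + h"
      using \<open>x \<in> segment_tube a b r\<close> by (auto simp: segment_tube_iff)
    then have "x - a = t *\<^sub>R (b - a) + h" by simp
    then have "w'' (x - a) - (x - a) w = w'' h - h w"
      using w(1)
      by (simp add: blinfun.add_left blinfun.add_right blinfun.scaleR_left blinfun.scaleR_right)
    moreover have "\<bar>w'' h\<bar> \<le> norm w'' * r"
      using norm_blinfun[of w'' h] mult_left_mono[of "norm h" r "norm w''"] h by simp
    moreover have "\<bar>h w\<bar> \<le> r * (2 * norm w'')"
      using norm_blinfun[of h w] mult_mono[of "norm h" r "norm w" "2 * norm w''"] h w(2)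
        norm_ge_zero[of h] by simp
    ultimately show ?thesis by (simp add: algebra_simps)
  qed
  then show thesis by (rule that)
qed

lemma type_FP_imp_type_NI:
  assumes FP: "type_FP G" and "G \<noteq> {}"
  shows "type_NI G"
proof (rule ccontr)
  assume "\<not> type_NI G"
  then obtain w' w'' \<delta> where "\<delta> > 0"
    and margin: "\<And>s s'. (s, s') \<in> G \<Longrightarrow> \<delta> \<le> blinfun_apply (canon s - w'') (s' - w')"
    unfolding type_NI_def by (force simp: not_less)
  obtain s0 s0' where "(s0, s0') \<in> G" using \<open>G \<noteq> {}\<close> by auto
  obtain w where w: "\<And>x r. x \<in> segment_tube w' s0' r \<Longrightarrow>
      \<bar>blinfun_apply w'' (x - w') - blinfun_apply (x - w') w\<bar> \<le> 3 * norm w'' * r"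
    using bidual_near_point_on_segment_tube[of w' s0' w''] by blast
  define \<eta> where "\<eta> = \<delta> / (3 * norm w'' + 1)"
  have \<eta>: "\<eta> > 0" "3 * norm w'' * \<eta> \<le> \<delta>"
    using \<open>\<delta> > 0\<close> by (auto simp: \<eta>_def field_simps add_pos_nonneg)
  define U where "U = segment_tube w' s0' \<eta>"
  have "w' \<in> U" "s0' \<in> U" unfolding U_def by (simp_all add: endpoints_in_segment_tube \<eta>)
  moreover have "U \<inter> range_mf G \<noteq> {}"
    using \<open>s0' \<in> U\<close> \<open>(s0, s0') \<in> G\<close> by (force simp: range_mf_def)
  moreover have "0 \<le> blinfun_apply (s' - w') (s - w)" if "(s, s') \<in> G" "s' \<in> U" for s s'
    using margin[OF that(1)] w[of s' \<eta>] that(2) \<eta>(2)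
    by (simp add: U_def blinfun.diff_left[of "canon s"] blinfun.diff_right[of "s' - w'"] abs_le_iff)
  ultimately have "(w, w') \<in> G"
    using FP open_segment_tube[of w' s0' \<eta>] convex_segment_tube[of w' s0' \<eta>]
    unfolding type_FP_def U_def by blast
  then show False using margin \<open>\<delta> > 0\<close> by fastforce
qed

section \<open>Negative infimum implies type (FP)\<close>

lemma blinfun_le_max_zero:
  fixes l p :: "'a::real_normed_vector \<Rightarrow>\<^sub>L real"
  assumes upper_bound: "\<And>z. l z \<le> max 0 (p z)"
  obtains t where "0 \<le> t" "t \<le> 1" "l = t *\<^sub>R p"
proof (cases "p = 0")
  case True
  then have "l z = 0" for z using upper_bound[of z] upper_bound[of "- z"] by (simp add: blinfun.minus_right)
  then have "l = 0 *\<^sub>R p" by (intro blinfun_eqI) simp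
  then show ?thesis by (intro that[of 0]) auto
next
  case False
  then obtain x where "p x \<noteq> 0" by (metis blinfun_eqI blinfun.zero_left)
  define e where "e = (1 / p x) *\<^sub>R x"
  have e: "p e = 1" using \<open>p x \<noteq> 0\<close> by (simp add: e_def blinfun.scaleR_right)
  have "l z = (l e *\<^sub>R p) z" for z
    using upper_bound[of "z - p z *\<^sub>R e"] upper_bound[of "- (z - p z *\<^sub>R e)"] e
    by (simp add: blinfun.diff_right blinfun.minus_right blinfun.scaleR_right blinfun.scaleR_left
        mult.commute)
  then have "l = l e *\<^sub>R p" by (rule blinfun_eqI)
  moreover have "0 \<le> l e" "l e \<le> 1"
    using upper_bound[of e] upper_bound[of "- e"] e by (auto simp: blinfun.minus_right)
  ultimately show ?thesis using that by blast
qed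

text \<open>The epigraph of the support function of the segment from 0 to p, thickened by \<open>\<eta>\<close>.\<close>
definition segment_support_epi :: "('a::real_normed_vector \<Rightarrow>\<^sub>L real) \<Rightarrow> real \<Rightarrow> ('a \<times> real) set" where
  "segment_support_epi p \<eta> = {(z, r). max 0 (p z) + \<eta> * norm z \<le> r}"

lemma convex_cone_segment_support_epi:
  assumes "\<eta> \<ge> 0"
  shows "convex_cone (segment_support_epi p \<eta>)"
  unfolding convex_cone_iff
proof (intro conjI ballI allI impI)
  show "0 \<in> segment_support_epi p \<eta>" by (simp add: segment_support_epi_def zero_prod_def)
next
  fix x y assume xy: "x \<in> segment_support_epi p \<eta>" "y \<in> segment_support_epi p \<eta>"
  have "\<eta> * norm (fst x + fst y) \<le> \<eta> * norm (fst x) + \<eta> * norm (fst y)"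
    using mult_left_mono[OF norm_triangle_ineq assms] by (simp add: distrib_left)
  moreover have "max 0 (p (fst x + fst y)) \<le> max 0 (p (fst x)) + max 0 (p (fst y))"
    by (simp add: blinfun.add_right)
  ultimately show "x + y \<in> segment_support_epi p \<eta>"
    using xy by (auto simp: segment_support_epi_def split_beta)
next
  fix x and c :: real assume x: "x \<in> segment_support_epi p \<eta>" "0 \<le> c"
  then have "c * (max 0 (p (fst x)) + \<eta> * norm (fst x)) \<le> c * snd x"
    by (intro mult_left_mono) (auto simp: segment_support_epi_def)
  then show "c *\<^sub>R x \<in> segment_support_epi p \<eta>"
    using x(2) by (simp add: segment_support_epi_def split_beta blinfun.scaleR_right
        max_mult_distrib_left distrib_left mult.left_commute)
qed

lemma cball_subset_dominated_segment_support_epi: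
  "cball p \<eta> \<subseteq> dominated_functionals (segment_support_epi p \<eta>)"
proof
  fix v assume "v \<in> cball p \<eta>"
  then have "norm (v - p) \<le> \<eta>" by (simp add: dist_norm norm_minus_commute)
  then have "(v - p) z \<le> \<eta> * norm z" for z
    using norm_blinfun[of "v - p" z] mult_right_mono[of "norm (v - p)" \<eta> "norm z"] by simp
  then have "v z \<le> max 0 (p z) + \<eta> * norm z" for z
    by (smt (verit) blinfun.diff_left)
  then show "v \<in> dominated_functionals (segment_support_epi p \<eta>)"
    by (auto simp: dominated_functionals_def segment_support_epi_def intro: order_trans)
qed

text \<open>The thickened segment is weak* compact, hence determined by its support function.\<close>
lemma dominated_segment_support_epi_near_segment:
  fixes p :: "'a::real_normed_vector \<Rightarrow>\<^sub>L real"
  assumes "\<eta> \<ge> 0" and v: "v \<in> dominated_functionals (segment_support_epi p \<eta>)"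
  obtains t where "0 \<le> t" "t \<le> 1" "norm (v - t *\<^sub>R p) \<le> \<eta>"
proof -
  define A where "A = epigraph UNIV (\<lambda>_::'a. 0) \<inter> epigraph UNIV (blinfun_apply p)"
  have A_iff: "(z, a) \<in> A \<longleftrightarrow> max 0 (p z) \<le> a" for z a by (simp add: A_def mem_epigraph)
  have "convex A"
    unfolding A_def
    by (intro convex_Int convex_epigraphI convex_on_linear convex_on_const[THEN iffD2]
        bounded_linear.linear[OF blinfun.bounded_linear_right] convex_UNIV)
  have concave: "concave_on UNIV (\<lambda>z. v z - \<eta> * norm z)"
    using \<open>\<eta> \<ge> 0\<close> by (intro concave_on_diff convex_on_cmul convex_on_norm)
      (simp_all add: concave_on_iff blinfun.add_right blinfun.scaleR_right)
  have "v z \<le> max 0 (p z) + \<eta> * norm z" for z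
    using v by (auto simp: dominated_functionals_def segment_support_epi_def)
  then have above: "v z - \<eta> * norm z \<le> a" if "(z, a) \<in> A" for z a
    using that unfolding A_iff by (smt (verit))
  have "(0, 0) \<in> A" by (simp add: A_iff)
  have bounded: "- norm v - \<eta> \<le> v z - \<eta> * norm z" if "z \<in> cball 0 1" for z
    using norm_blinfun[of v z] mult_left_mono[of "norm z" 1 "norm v"]
      mult_left_mono[of "norm z" 1 \<eta>] that \<open>\<eta> \<ge> 0\<close> by simp
  obtain l k where l_le: "\<And>z a. (z, a) \<in> A \<Longrightarrow> blinfun_apply l z + k \<le> a"
    and l_ge: "\<And>z. z \<in> UNIV \<Longrightarrow> v z - \<eta> * norm z \<le> blinfun_apply l z + k"
    using convex_sandwich[OF \<open>convex A\<close> concave above \<open>(0, 0) \<in> A\<close> zero_less_one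
        subset_UNIV bounded] by blast
  have "k = 0" using l_le[of 0 0] l_ge[of 0] by (simp add: A_iff)
  then have "l z \<le> max 0 (p z)" for z using l_le[of z "max 0 (p z)"] by (simp add: A_iff)
  then obtain t where t: "0 \<le> t" "t \<le> 1" "l = t *\<^sub>R p" by (rule blinfun_le_max_zero)
  have "norm (v - l) \<le> \<eta>"
  proof (rule norm_blinfun_bound[OF \<open>\<eta> \<ge> 0\<close>])
    show "norm ((v - l) z) \<le> \<eta> * norm z" for z
      using l_ge[of z] l_ge[of "- z"] \<open>k = 0\<close>
      by (simp add: blinfun.diff_left blinfun.minus_right abs_le_iff)
  qed
  then show thesis using t by (intro that) simp_all
qed

text \<open>This is the quasidensity argument for the inverse of the sum of the inverse of G and the
  normal cone of the functionals dominated by \<open>\<Sigma>\<close>.\<close>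
lemma type_NI_localized_enlargement_near:
  assumes G: "maximally_monotone G" and NI: "type_NI G" and "\<epsilon> > 0"
    and \<Sigma>: "convex_cone \<Sigma>" and "s0 \<in> G"
    and \<eta>: "\<eta> > 0" "cball (snd (s0 - c)) \<eta> \<subseteq> dominated_functionals \<Sigma>"
  obtains u y' z r where "(z, r) \<in> \<Sigma>" "y' \<in> dominated_functionals \<Sigma>"
    "c + (u, y') \<in> enlargement G \<epsilon>" "coupling (u, y') + r + (norm (u + z, y'))\<^sup>2 / 2 < \<epsilon>"
proof -
  define F where "F = fitzpatrick_epi G c"
  have F: "convex F" "conjugate_ge_coupling F"
    unfolding F_def by (rule convex_fitzpatrick_epi, rule type_NI_conjugate_fitzpatrick[OF G NI])
  have "((fst (s0 - c), snd (s0 - c)), coupling (s0 - c)) \<in> F"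
    unfolding F_def prod.collapse by (rule graph_in_fitzpatrick_epi[OF G \<open>s0 \<in> G\<close>])
  then have conj: "conjugate_ge_coupling (localized_epi \<Sigma> F)"
    by (rule conjugate_ge_coupling_localized_epi[OF F \<Sigma> _ \<eta>])
  have "convex (localized_epi \<Sigma> F)"
    using F(1) \<Sigma> by (intro convex_localized_epi) (simp_all add: convex_cone_def)
  then obtain b a where "(b, a) \<in> localized_epi \<Sigma> F" "a + (norm b)\<^sup>2 / 2 < \<epsilon>"
    by (rule conjugate_ge_coupling_plus_half_norm_square_less[OF _ conj \<open>\<epsilon> > 0\<close>])
  then obtain u z y' a r where ua: "((u, y'), a) \<in> F" and y': "y' \<in> dominated_functionals \<Sigma>"
    and z: "(z, r) \<in> \<Sigma>" and less: "a + r + (norm (u + z, y'))\<^sup>2 / 2 < \<epsilon>"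
    by (auto simp: localized_epi_def)
  define e where "e = a - coupling (u, y')"
  have enlarged: "c + (u, y') \<in> enlargement G e"
    using ua by (simp add: F_def e_def fitzpatrick_epi_iff_enlargement)
  have "y' z \<le> r" using y' z by (auto simp: dominated_functionals_def)
  moreover have "coupling (u + z, y') = coupling (u, y') + y' z"
    by (simp add: coupling_def blinfun.add_right)
  ultimately have "e \<le> \<epsilon>"
    using less regularized_coupling_nonneg[of "(u + z, y')"]
    unfolding regularized_coupling_def e_def by linarith
  show thesis
  proof (rule that[OF z y'])
    show "c + (u, y') \<in> enlargement G \<epsilon>" using enlarged enlargement_mono[OF \<open>e \<le> \<epsilon>\<close>] by blast
    show "coupling (u, y') + r + (norm (u + z, y'))\<^sup>2 / 2 < \<epsilon>"
      using less enlargement_nonneg[OF G enlarged] unfolding e_def by linarith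
  qed
qed

lemma quadratic_estimate_sum_le:
  fixes X Y Z \<tau> \<eta> :: real
  assumes "\<tau> > 0" "12 * \<tau> \<le> \<eta>" "Z \<ge> 0"
    and estimate: "\<eta> * Z + X\<^sup>2 / 2 + Y\<^sup>2 / 2 \<le> 19 * \<tau>\<^sup>2 + 6 * \<tau> * (X + Y + Z)"
  shows "X + Y + Z \<le> 44 * \<tau>"
proof -
  have "12 * \<tau> * Z \<le> \<eta> * Z" using assms(2,3) by (rule mult_right_mono)
  then have squares_le: "(X - 6 * \<tau>)\<^sup>2 / 2 + (Y - 6 * \<tau>)\<^sup>2 / 2 + 6 * \<tau> * Z \<le> 55 * \<tau>\<^sup>2"
    using estimate by (simp add: power2_diff power_mult_distrib diff_divide_distrib add_divide_distrib
        algebra_simps)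
  have nonneg: "0 \<le> (X - 6 * \<tau>)\<^sup>2" "0 \<le> (Y - 6 * \<tau>)\<^sup>2" "0 \<le> \<tau> * Z" "0 \<le> \<tau>\<^sup>2"
    using assms by simp_all
  have square: "(11 * \<tau>)\<^sup>2 = 121 * \<tau>\<^sup>2" by (simp add: power_mult_distrib)
  have root: "w \<le> 17 * \<tau>" if "(w - 6 * \<tau>)\<^sup>2 \<le> (11 * \<tau>)\<^sup>2" for w
    using power2_le_imp_le[OF that] assms(1) by simp
  have "(X - 6 * \<tau>)\<^sup>2 \<le> (11 * \<tau>)\<^sup>2" "(Y - 6 * \<tau>)\<^sup>2 \<le> (11 * \<tau>)\<^sup>2"
    using squares_le nonneg unfolding square by linarith+
  then have "X \<le> 17 * \<tau>" "Y \<le> 17 * \<tau>" by (simp_all only: root)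
  moreover have "\<tau> * Z \<le> \<tau> * (10 * \<tau>)"
    using squares_le nonneg unfolding power2_eq_square[of \<tau>] by linarith
  then have "Z \<le> 10 * \<tau>" using assms(1) by simp
  ultimately show ?thesis by linarith
qed

lemma related_perturbation_norm_le:
  fixes u z :: "'a::real_normed_vector" and y' :: "'a \<Rightarrow>\<^sub>L real"
  assumes \<tau>: "\<tau> > 0" "12 * \<tau> \<le> \<eta>" and h: "norm h \<le> 6 * \<tau>" and "0 \<le> coupling ((u, y') + h)"
    and less: "coupling (u, y') + \<eta> * norm z + (norm (u + z, y'))\<^sup>2 / 2 < \<tau>\<^sup>2"
  shows "norm ((u, y') + h) \<le> 50 * \<tau>"
proof -
  define d where "d = (u, y')"
  define X Y Z where XYZ: "X = norm (u + z)" "Y = norm y'" "Z = norm z"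
  have "norm u \<le> X + Z" using norm_triangle_ineq4[of "u + z" z] by (simp add: XYZ)
  then have d: "norm d \<le> X + Y + Z" using norm_Pair_le[of u y'] by (simp add: d_def XYZ)
  have "pairing d h \<le> norm d * norm h" using abs_pairing_le[of d h] by linarith
  also have "\<dots> \<le> (X + Y + Z) * (6 * \<tau>)" using d h by (intro mult_mono) (auto simp: XYZ)
  finally have "pairing d h \<le> 6 * \<tau> * (X + Y + Z)" by (simp only: mult.commute)
  moreover have "coupling h \<le> 18 * \<tau>\<^sup>2"
    using abs_coupling_le[of h] power_mono[OF h, of 2] by (simp add: power_mult_distrib)
  moreover have "0 \<le> coupling d + pairing d h + coupling h"
    using assms(4) unfolding d_def[symmetric] coupling_add by simp
  moreover have "(norm (u + z, y'))\<^sup>2 = X\<^sup>2 + Y\<^sup>2" by (simp add: norm_Pair XYZ)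
  ultimately have "\<eta> * Z + X\<^sup>2 / 2 + Y\<^sup>2 / 2 \<le> 19 * \<tau>\<^sup>2 + 6 * \<tau> * (X + Y + Z)"
    using less unfolding d_def[symmetric] XYZ(3)[symmetric] by linarith
  then have "X + Y + Z \<le> 44 * \<tau>" using \<tau> by (intro quadratic_estimate_sum_le) (auto simp: XYZ)
  then show ?thesis using norm_triangle_ineq[of d h] d h unfolding d_def by linarith
qed

lemma type_NI_graph_point_over_segment_tube:
  fixes G :: "('a::banach \<times> ('a \<Rightarrow>\<^sub>L real)) set"
  assumes G: "maximally_monotone G" and NI: "type_NI G" and "s0 \<in> G"
    and \<tau>: "\<tau> > 0" "6 * \<tau> < \<eta>"
  obtains s u y' z where "s \<in> G" "snd s \<in> segment_tube (snd c) (snd s0) (2 * \<eta>)"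
    "norm (s - (c + (u, y'))) \<le> 6 * \<tau>"
    "coupling (u, y') + \<eta> * norm z + (norm (u + z, y'))\<^sup>2 / 2 < \<tau>\<^sup>2"
proof -
  define p where "p = snd (s0 - c)"
  have "\<eta> > 0" "\<tau>\<^sup>2 > 0" using \<tau> by simp_all
  obtain u y' z r where zr: "(z, r) \<in> segment_support_epi p \<eta>"
    and y': "y' \<in> dominated_functionals (segment_support_epi p \<eta>)"
    and b: "c + (u, y') \<in> enlargement G (\<tau>\<^sup>2)"
    and less: "coupling (u, y') + r + (norm (u + z, y'))\<^sup>2 / 2 < \<tau>\<^sup>2"
    unfolding p_def
    using type_NI_localized_enlargement_near[OF G NI \<open>\<tau>\<^sup>2 > 0\<close>
        convex_cone_segment_support_epi[OF less_imp_le[OF \<open>\<eta> > 0\<close>]] \<open>s0 \<in> G\<close> \<open>\<eta> > 0\<close>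
        cball_subset_dominated_segment_support_epi] .
  obtain s where s: "s \<in> G" "norm (s - (c + (u, y'))) \<le> 6 * \<tau>"
    using type_NI_enlargement_close[OF G NI \<tau>(1) b] .
  obtain t where t: "0 \<le> t" "t \<le> 1" "norm (y' - t *\<^sub>R p) \<le> \<eta>"
    by (rule dominated_segment_support_epi_near_segment[OF less_imp_le[OF \<open>\<eta> > 0\<close>] y'])
  define h where "h = s - (c + (u, y'))"
  have "snd s = snd c + t *\<^sub>R (snd s0 - snd c) + (y' - t *\<^sub>R p + snd h)"
    by (simp add: h_def p_def)
  moreover have "norm (y' - t *\<^sub>R p + snd h) < 2 * \<eta>"
    using norm_triangle_ineq[of "y' - t *\<^sub>R p" "snd h"] t(3)
      norm_snd_le[of "snd h" "fst h"] s(2) \<tau>(2)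
    unfolding h_def prod.collapse by linarith
  ultimately have "snd s \<in> segment_tube (snd c) (snd s0) (2 * \<eta>)"
    unfolding segment_tube_iff using t(1,2) by blast
  moreover have "\<eta> * norm z \<le> r" using zr by (auto simp: segment_support_epi_def)
  then have "coupling (u, y') + \<eta> * norm z + (norm (u + z, y'))\<^sup>2 / 2 < \<tau>\<^sup>2" using less by linarith
  ultimately show thesis using s that by blast
qed

lemma type_NI_imp_type_FP:
  fixes G :: "('a::banach \<times> ('a \<Rightarrow>\<^sub>L real)) set"
  assumes G: "maximally_monotone G" and NI: "type_NI G"
  shows "type_FP G"
  unfolding type_FP_def
proof (intro conjI allI impI)
  show "monotone_mf G" using G by (simp add: maximally_monotone_def)
next
  fix U w w'
  assume U: "open U \<and> convex U \<and> U \<inter> range_mf G \<noteq> {} \<and> w' \<in> U \<and>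
     (\<forall>(s, s')\<in>G. s' \<in> U \<longrightarrow> 0 \<le> blinfun_apply (s' - w') (s - w))"
  then obtain s0 where s0: "s0 \<in> G" "snd s0 \<in> U" by (auto simp: range_mf_def)
  then obtain \<rho> where "\<rho> > 0" and tube: "segment_tube w' (snd s0) \<rho> \<subseteq> U"
    using U open_convex_contains_segment_tube by metis
  define c where "c = (w, w')"
  define \<eta> where "\<eta> = \<rho> / 2"
  then have "\<eta> > 0" using \<open>\<rho> > 0\<close> by simp
  have related: "0 \<le> coupling (s - c)"
    if "s \<in> G" "snd s \<in> segment_tube (snd c) (snd s0) (2 * \<eta>)" for s
    using U that tube by (auto simp: c_def \<eta>_def coupling_def split: prod.splits)
  have "c \<in> closure G"
    unfolding closure_approachable
  proof (intro allI impI)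
    fix r :: real assume "r > 0"
    define \<tau> where "\<tau> = min (\<eta> / 12) (r / 51)"
    have \<tau>: "0 < \<tau>" "12 * \<tau> \<le> \<eta>" "50 * \<tau> < r"
      using \<open>r > 0\<close> \<open>\<eta> > 0\<close> by (auto simp: \<tau>_def min_def)
    then have "6 * \<tau> < \<eta>" by linarith
    obtain s u y' z where s: "s \<in> G" "snd s \<in> segment_tube (snd c) (snd s0) (2 * \<eta>)"
        "norm (s - (c + (u, y'))) \<le> 6 * \<tau>"
      and small: "coupling (u, y') + \<eta> * norm z + (norm (u + z, y'))\<^sup>2 / 2 < \<tau>\<^sup>2"
      using type_NI_graph_point_over_segment_tube[OF G NI s0(1) \<tau>(1) \<open>6 * \<tau> < \<eta>\<close>] .
    have "(u, y') + (s - (c + (u, y'))) = s - c" by simp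
    then have "norm (s - c) \<le> 50 * \<tau>"
      using related_perturbation_norm_le[OF \<tau>(1,2) s(3) _ small] related[OF s(1,2)] by metis
    then show "\<exists>s\<in>G. dist s c < r"
      using s(1) \<tau>(3) by (intro bexI[of _ s]) (simp_all add: dist_norm)
  qed
  then show "(w, w') \<in> G" using maximally_monotone_imp_closed[OF G] by (simp add: c_def)
qed

theorem theorem8p3:
  fixes G :: "('a::banach \<times> ('a \<Rightarrow>\<^sub>L real)) set"
  assumes "\<exists>x::'a. x \<noteq> 0"
    and "G \<noteq> {}"
    and "maximally_monotone G"
  shows "(quasidense G \<longleftrightarrow> type_FP G) \<and>
         (type_FP G \<longleftrightarrow>
           (\<forall>(w' :: 'a \<Rightarrow>\<^sub>L real) (w'' :: ('a \<Rightarrow>\<^sub>L real) \<Rightarrow>\<^sub>L real).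
              (INF p\<in>G. ereal (blinfun_apply (canon (fst p) - w'') (snd p - w'))) \<le> 0))"
proof -
  have "type_NI G \<longleftrightarrow> quasidense G"
    using type_NI_imp_quasidense[OF assms(3,2)] quasidense_imp_type_NI by blast
  moreover have "type_NI G \<longleftrightarrow> type_FP G"
    using type_NI_imp_type_FP[OF assms(3)] type_FP_imp_type_NI assms(2) by blast
  ultimately show ?thesis
    unfolding INF_ereal_le_zero_iff type_NI_def[symmetric] by blast
qed

end
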